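(* Let $d\geqslant 1$ and $k\in\mathbb N_0$ be integers, let $\Omega\subset\mathbb R^d$ be a bounded open polyhedral set and $\mathcal T$ a conforming simplicial mesh of $\Omega$. Let $M=\binom{d+k}{d}=\dim\mathbb P_k(\mathbb R^d)$. Then $\mathrm{NN}_d^1(k;2H_{\mathcal T},MN_{\mathcal T})$ realizes $\mathring{\mathcal V}_k^{\mathrm{DG}}(\mathcal T)$ pointwise on $\overline\Omega$: every $v\in\mathring{\mathcal V}_k^{\mathrm{DG}}(\mathcal T)$ agrees at every point of $\overline\Omega$ with some member of $\mathrm{NN}_d^1(k;2H_{\mathcal T},MN_{\mathcal T})$. Moreover, for fixed $d$ and $k$, all hidden parameters $\boldsymbol W_{\mathrm I},\boldsymbol b_{\mathrm I},\boldsymbol W_{\mathrm{II},0},\boldsymbol W_{\mathrm{II},1},\boldsymbol b_{\mathrm{II}}$ are determined by the mesh, and only the output coefficients $\boldsymbol W_{\mathrm{III}}$ vary with $v$ (that is, the hidden parameters can be chosen once, before $v$, so that for every $v\in\mathring{\mathcal V}_k^{\mathrm{DG}}(\mathcal T)$ there is a $\boldsymbol W_{\mathrm{III}}$ representing $v$ pointwise on $\overline\Omega$).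
   Context: Mesh. $\Omega\subset\mathbb R^d$ is a bounded open polyhedral set, not necessarily convex or connected. A conforming simplicial mesh $\mathcal T=\{\tau_1,\dots,\tau_{N_{\mathcal T}}\}$ of $\Omega$ is a finite collection of pairwise disjoint open $d$-simplices $\tau_i\subset\Omega$ (elements) with $\bigcup_{\tau\in\mathcal T}\overline\tau=\overline\Omega$ such that for $i\neq j$ the set $\overline\tau_i\cap\overline\tau_j$ is either empty or a common subsimplex (face) of both. $N_{\mathcal T}$ is the number of elements. The skeleton is $\partial\mathcal T=\bigcup_{\tau\in\mathcal T}\partial\tau$. $H_{\mathcal T}$ is the number of distinct unoriented affine hyperplanes supporting the $(d-1)$-dimensional facets of elements (coplanar facets contribute only once). Function space. $\mathbb P_k(\tau)$ denotes the real polynomials of total degree at most $k$ on $\tau$. $\mathring{\mathcal V}_k^{\mathrm{DG}}(\mathcal T)$ is the space of functions $v:\overline\Omega\to\mathbb R$ such that $v|_\tau\in\mathbb P_k(\tau)$ for every (open) $\tau\in\mathcal T$ and $v=0$ on $\partial\mathcal T$. Networks. $\varrho_0(t)=\mathbf 1_{\{t>0\}}$ and $\varrho_j(t)=(\max\{t,0\})^j$ for $j\geqslant1$, applied componentwise to vectors. For positive integers $d,m,n_1,n_2$ and $k\in\mathbb N_0$, $\mathrm{NN}_d^m(k;n_1,n_2)$ is the class of functions $\mathbb R^d\to\mathbb R^m$ of the form $$\boldsymbol x\mapsto\boldsymbol W_{\mathrm{III}}\,\varrho_k\big(\boldsymbol W_{\mathrm{II},0}\varrho_0(\boldsymbol W_{\mathrm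 I}\boldsymbol x+\boldsymbol b_{\mathrm I})+\boldsymbol W_{\mathrm{II},1}\varrho_1(\boldsymbol W_{\mathrm I}\boldsymbol x+\boldsymbol b_{\mathrm I})+\boldsymbol b_{\mathrm{II}}\big)$$ with $\boldsymbol W_{\mathrm I}\in\mathbb R^{n_1\times d}$, $\boldsymbol b_{\mathrm I}\in\mathbb R^{n_1}$, $\boldsymbol W_{\mathrm{II},0},\boldsymbol W_{\mathrm{II},1}\in\mathbb R^{n_2\times n_1}$, $\boldsymbol b_{\mathrm{II}}\in\mathbb R^{n_2}$, $\boldsymbol W_{\mathrm{III}}\in\mathbb R^{m\times n_2}$. All parameters other than $\boldsymbol W_{\mathrm{III}}$ are called hidden parameters; the entries of $\boldsymbol W_{\mathrm{III}}$ are the output coefficients. *)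

theory Defs
  imports "HOL-Analysis.Analysis"
begin

text \<open>
  The requirement on the closure is the most permissive reading of ``polyhedral'': it admits
  nonconvex and disconnected sets, and also slit domains.
\<close>
definition open_polyhedral :: "'a::euclidean_space set \<Rightarrow> bool" where
  "open_polyhedral \<Omega> \<longleftrightarrow> open \<Omega> \<and> bounded \<Omega> \<and>
     (\<exists>\<P>. finite \<P> \<and> (\<forall>P\<in>\<P>. polytope P) \<and> closure \<Omega> = \<Union>\<P>)"

definition open_simplex :: "'a::euclidean_space set \<Rightarrow> bool" where
  "open_simplex \<tau> \<longleftrightarrow> (\<exists>S. int DIM('a) simplex S \<and> \<tau> = interior S)"

definition conforming_mesh :: "'a::euclidean_space set \<Rightarrow> 'a set set \<Rightarrow> bool" where
  "conforming_mesh \<Omega> \<T> \<longleftrightarrow>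
     finite \<T> \<and>
     (\<forall>\<tau>\<in>\<T>. open_simplex \<tau> \<and> \<tau> \<subseteq> \<Omega>) \<and>
     pairwise disjnt \<T> \<and>
     (\<Union>\<tau>\<in>\<T>. closure \<tau>) = closure \<Omega> \<and>
     (\<forall>\<tau>\<in>\<T>. \<forall>\<tau>'\<in>\<T>. \<tau> \<noteq> \<tau>' \<longrightarrow>
        closure \<tau> \<inter> closure \<tau>' = {} \<or>
        (closure \<tau> \<inter> closure \<tau>' face_of closure \<tau> \<and>
         closure \<tau> \<inter> closure \<tau>' face_of closure \<tau>'))"

definition skeleton :: "'a::euclidean_space set set \<Rightarrow> 'a set" where
  "skeleton \<T> = (\<Union>\<tau>\<in>\<T>. frontier \<tau>)"

text \<open>
  A facet of a full-dimensional simplex has codimension one, so its affine hull is the supporting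
  hyperplane; as these are collected as point sets, orientation and repetition do not count.
\<close>
definition facet_hyperplanes :: "'a::euclidean_space set set \<Rightarrow> 'a set set" where
  "facet_hyperplanes \<T> = {affine hull F | F \<tau>. \<tau> \<in> \<T> \<and> F facet_of closure \<tau>}"

definition monomial :: "('d::finite \<Rightarrow> nat) \<Rightarrow> real ^ 'd \<Rightarrow> real" where
  "monomial \<alpha> x = (\<Prod>i\<in>UNIV. (x $ i) ^ \<alpha> i)"

definition multi_indices :: "nat \<Rightarrow> ('d::finite \<Rightarrow> nat) set" where
  "multi_indices k = {\<alpha>. (\<Sum>i\<in>UNIV. \<alpha> i) \<le> k}"

lemma finite_multi_indices: "finite (multi_indices k :: ('d::finite \<Rightarrow> nat) set)"
proof -
  have "multi_indices k \<subseteq> (PiE UNIV (\<lambda>_. {..k}) :: ('d \<Rightarrow> nat) set)"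
  proof
    fix \<alpha> :: "'d \<Rightarrow> nat"
    assume "\<alpha> \<in> multi_indices k"
    then have "\<alpha> i \<le> k" for i
      using member_le_sum[of i UNIV \<alpha>] by (auto simp: multi_indices_def intro: order_trans)
    then show "\<alpha> \<in> PiE UNIV (\<lambda>_. {..k})" by auto
  qed
  then show ?thesis by (rule finite_subset) (simp add: finite_PiE)
qed

definition polys :: "nat \<Rightarrow> (real ^ 'd \<Rightarrow> real) set" where
  "polys k = {p. \<exists>c. \<forall>x. p x = (\<Sum>\<alpha>\<in>multi_indices k. c \<alpha> * monomial \<alpha> x)}"

text \<open>
  Functions on the closed domain are represented by total functions. The elements and the skeleton
  cover exactly the closed domain, so values elsewhere are unconstrained and never used.
\<close>
definition DG0 :: "nat \<Rightarrow> (real ^ 'd) set set \<Rightarrow> (real ^ 'd \<Rightarrow> real) set" where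
  "DG0 k \<T> = {v. (\<forall>\<tau>\<in>\<T>. \<exists>p\<in>polys k. \<forall>x\<in>\<tau>. v x = p x) \<and> (\<forall>x\<in>skeleton \<T>. v x = 0)}"

definition rho :: "nat \<Rightarrow> real \<Rightarrow> real" where
  "rho j t = (if j = 0 then of_bool (t > 0) else (max t 0) ^ j)"

text \<open>
  The hidden widths \<open>n1\<close>, \<open>n2\<close> are terms, so hidden neurons are indexed by \<open>{..<n1}\<close> and
  \<open>{..<n2}\<close>; matrix entries and bias components outside these ranges are ignored.
  \<open>W1 i\<close> is the \<open>i\<close>-th row of the first weight matrix.
\<close>
definition network ::
  "nat \<Rightarrow> nat \<Rightarrow> nat \<Rightarrow> (nat \<Rightarrow> real ^ 'd) \<Rightarrow> (nat \<Rightarrow> real) \<Rightarrow>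
   (nat \<Rightarrow> nat \<Rightarrow> real) \<Rightarrow> (nat \<Rightarrow> nat \<Rightarrow> real) \<Rightarrow> (nat \<Rightarrow> real) \<Rightarrow>
   ('m \<Rightarrow> nat \<Rightarrow> real) \<Rightarrow> real ^ 'd \<Rightarrow> real ^ 'm" where
  "network k n1 n2 W1 b1 W20 W21 b2 W3 x =
     (\<chi> l. \<Sum>j<n2. W3 l j *
        rho k ((\<Sum>i<n1. W20 j i * rho 0 (W1 i \<bullet> x + b1 i)) +
               (\<Sum>i<n1. W21 j i * rho 1 (W1 i \<bullet> x + b1 i)) + b2 j))"

definition NN :: "nat \<Rightarrow> nat \<Rightarrow> nat \<Rightarrow> (real ^ 'd \<Rightarrow> real ^ 'm) set" where
  "NN k n1 n2 = {f. \<exists>W1 b1 W20 W21 b2 W3. f = network k n1 n2 W1 b1 W20 W21 b2 W3}"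

end

theory Submission
  imports Defs "HOL-Library.Function_Algebras"
begin

text \<open>
  Each neuron of the second layer computes \<open>l x ^ k\<close> inside one element and 0 on the rest of the
  closed domain, where \<open>l\<close> is an affine form that is positive on the whole domain. Two facts make
  this work.

  The first is geometric. An open simplex is the set of points that lie strictly on the inner side
  of each of its facet hyperplanes. With both orientations of every hyperplane in the first layer, the
  Heaviside units count the facet conditions that hold at a point, and every violated condition is
  charged a penalty \<open>B\<close> that is an upper bound of \<open>l\<close> on the domain. The argument of the
  neuron is then \<open>l x\<close> inside the element and at most 0 elsewhere, in particular on the skeleton,
  where some condition fails for every element because the inequalities are strict (\<open>rho_gate\<close>).
  The form \<open>l\<close> itself comes from the linear rectifiers: the difference of the two
  orientations is the signed value of the hyperplane equation, and the normals of a bounded simplex span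
  the space (\<open>bounded_cell_normals_span\<close>).

  The second is algebraic. Finitely many powers \<open>l ^ k\<close> of positive affine forms, at most as many as
  there are monomials, span the polynomials of degree at most \<open>k\<close>
  (\<open>positive_powers_basis\<close>). By polarization, a product of \<open>k\<close> affine forms is an iterated
  difference of \<open>k\<close>-th powers, and moving the base point to a large constant keeps all the forms
  positive on a bounded set. Every monomial is such a product, so the positive powers span, and
  the exchange lemma extracts a sufficiently small spanning family.

  An element of the space is thus reproduced by taking its local coefficients with respect to these
  powers as output coefficients (\<open>gated_hidden_layers\<close>). Only these depend on the function.
\<close>

section \<open>Polynomials as combinations of powers of positive affine forms\<close>

definition affine_form :: "'a::real_inner \<times> real \<Rightarrow> 'a \<Rightarrow> real" where
  "affine_form l x = fst l \<bullet> x + snd l"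

primrec iterated_difference :: "real list \<Rightarrow> (real \<Rightarrow> real) \<Rightarrow> real \<Rightarrow> real" where
  "iterated_difference [] f z = f z"
| "iterated_difference (y # ys) f z =
     iterated_difference ys f (z + y) - iterated_difference ys f z"

lemma iterated_difference_linear:
  "iterated_difference ys (\<lambda>t. \<Sum>i\<in>A. c i * f i t) z =
     (\<Sum>i\<in>A. c i * iterated_difference ys (f i) z)"
  by (induction ys arbitrary: z) (auto simp: sum_subtractf right_diff_distrib)

lemma iterated_difference_Cons_inner:
  "iterated_difference (y # ys) f z = iterated_difference ys (\<lambda>t. f (t + y) - f t) z"
proof (induction ys arbitrary: z)
  case (Cons a ys)
  have "iterated_difference (y # a # ys) f z =
      iterated_difference (y # ys) f (z + a) - iterated_difference (y # ys) f z"
    by (simp add: algebra_simps)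
  then show ?case unfolding Cons.IH by simp
qed simp

text \<open>
  Each difference lowers the degree of a polynomial by one and multiplies its leading coefficient
  by the degree and by the increment. This is the polarization formula: it writes a product of
  \<open>n\<close> numbers as a combination of \<open>n\<close>-th powers of their subset sums, all shifted by \<open>z\<close>. The
  shift is free, which is what makes it possible to keep the bases of the powers positive.
\<close>
lemma iterated_difference_power:
  assumes "m \<le> length ys"
  shows "iterated_difference ys (\<lambda>t. t ^ m) z =
    (if m = length ys then fact m * prod_list ys else 0)"
  using assms
proof (induction ys arbitrary: m z)
  case (Cons y ys)
  have "(t + y) ^ m - t ^ m = (\<Sum>i<m. (real (m choose i) * y ^ (m - i)) * t ^ i)" for t
    by (simp add: binomial_ring lessThan_Suc_atMost[symmetric] algebra_simps)
  then have "iterated_difference (y # ys) (\<lambda>t. t ^ m) z =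
      iterated_difference ys (\<lambda>t. \<Sum>i<m. (real (m choose i) * y ^ (m - i)) * t ^ i) z"
    by (simp only: iterated_difference_Cons_inner)
  also have "\<dots> = (\<Sum>i<m. (real (m choose i) * y ^ (m - i)) *
      iterated_difference ys (\<lambda>t. t ^ i) z)"
    by (rule iterated_difference_linear)
  also have "\<dots> = (\<Sum>i<m. (real (m choose i) * y ^ (m - i)) *
      (if i = length ys then fact i * prod_list ys else 0))"
    by (intro sum.cong refl, subst Cons.IH) (use Cons.prems in auto)
  also have "\<dots> = (\<Sum>i<m. if i = length ys then
      real (m choose i) * y ^ (m - i) * (fact i * prod_list ys) else 0)"
    by (rule sum.cong) auto
  also have "\<dots> = (if m = length (y # ys) then fact m * prod_list (y # ys) else 0)"
    using Cons.prems by (auto simp: sum.delta algebra_simps)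
  finally show ?case .
qed simp

text \<open>
  Real functions as a vector space, so that spans and the exchange lemma apply to polynomial functions.
\<close>
interpretation function_space: vector_space "\<lambda>(c::real) (f::'a \<Rightarrow> real) x. c * f x"
  by unfold_locales (auto simp: fun_eq_iff algebra_simps)

lemma sum_fun_apply: "(\<Sum>i\<in>A. F i) x = (\<Sum>i\<in>A. F i x)"
  for F :: "'i \<Rightarrow> 'a \<Rightarrow> 'b::comm_monoid_add"
  by (induction A rule: infinite_finite_induct) auto

definition positive_powers :: "'a::real_inner set \<Rightarrow> nat \<Rightarrow> ('a \<Rightarrow> real) set" where
  "positive_powers K k = {\<lambda>x. affine_form l x ^ k | l. \<forall>x\<in>K. 0 < affine_form l x}"

text \<open>
  The difference is taken in the values of affine forms, so unfolding it only evaluates \<open>k\<close>-th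
  powers of \<open>l0\<close> plus sums of sublists of \<open>ls\<close>. The hypothesis says that \<open>l0\<close> is
  so large that all these sums stay positive on \<open>K\<close>.
\<close>
lemma iterated_difference_in_span_positive_powers:
  assumes "\<And>x. x \<in> K \<Longrightarrow> (\<Sum>l\<leftarrow>ls. \<bar>affine_form l x\<bar>) < affine_form l0 x"
  shows "(\<lambda>x. iterated_difference (map (\<lambda>l. affine_form l x) ls) (\<lambda>t. t ^ k) (affine_form l0 x))
    \<in> function_space.span (positive_powers K k)"
  using assms
proof (induction ls arbitrary: l0)
  case Nil
  then have "\<forall>x\<in>K. 0 < affine_form l0 x" by simp
  then have "(\<lambda>x. affine_form l0 x ^ k) \<in> positive_powers K k"
    unfolding positive_powers_def by blast
  then show ?case
    by (simp add: function_space.span_base)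
next
  case (Cons l ls)
  have add: "affine_form (l0 + l) x = affine_form l0 x + affine_form l x" for x
    by (simp add: affine_form_def inner_add_left)
  let ?D = "\<lambda>l' x. iterated_difference (map (\<lambda>l. affine_form l x) ls) (\<lambda>t. t ^ k) (affine_form l' x)"
  have "?D (l0 + l) \<in> function_space.span (positive_powers K k)"
    by (rule Cons.IH) (use Cons.prems in \<open>fastforce simp: add\<close>)
  moreover have "?D l0 \<in> function_space.span (positive_powers K k)"
    by (rule Cons.IH) (use Cons.prems in fastforce)
  ultimately have "?D (l0 + l) - ?D l0 \<in> function_space.span (positive_powers K k)"
    by (rule function_space.span_diff)
  moreover have "?D (l0 + l) - ?D l0 =
    (\<lambda>x. iterated_difference (map (\<lambda>l. affine_form l x) (l # ls)) (\<lambda>t. t ^ k) (affine_form l0 x))"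
    by (simp add: fun_eq_iff add)
  ultimately show ?case by simp
qed

lemma affine_forms_bounded:
  assumes "bounded K"
  shows "\<exists>N. \<forall>x\<in>K. (\<Sum>l\<leftarrow>ls. \<bar>affine_form l x\<bar>) < N"
proof -
  obtain R where R: "\<And>x. x \<in> K \<Longrightarrow> norm x \<le> R"
    using assms unfolding bounded_iff by blast
  have "\<bar>affine_form l x\<bar> \<le> norm (fst l) * R + \<bar>snd l\<bar>" if "x \<in> K" for l x
  proof -
    have "\<bar>fst l \<bullet> x\<bar> \<le> norm (fst l) * norm x" by (rule Cauchy_Schwarz_ineq2)
    also have "\<dots> \<le> norm (fst l) * R" using R[OF that] by (simp add: mult_left_mono)
    finally show ?thesis unfolding affine_form_def by linarith
  qed
  then have "(\<Sum>l\<leftarrow>ls. \<bar>affine_form l x\<bar>) \<le> (\<Sum>l\<leftarrow>ls. norm (fst l) * R + \<bar>snd l\<bar>)" if "x \<in> K" for x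
    using that by (intro sum_list_mono) auto
  then show ?thesis
    by (intro exI[of _ "(\<Sum>l\<leftarrow>ls. norm (fst l) * R + \<bar>snd l\<bar>) + 1"]) fastforce
qed

text \<open>
  Polarization with a large constant as base point.
\<close>
lemma affine_product_in_span_positive_powers:
  assumes "bounded K" and "length ls = k"
  shows "(\<lambda>x. prod_list (map (\<lambda>l. affine_form l x) ls))
    \<in> function_space.span (positive_powers K k)"
proof -
  obtain N where N: "\<forall>x\<in>K. (\<Sum>l\<leftarrow>ls. \<bar>affine_form l x\<bar>) < N"
    using affine_forms_bounded[OF assms(1)] by blast
  let ?D = "\<lambda>x. iterated_difference (map (\<lambda>l. affine_form l x) ls) (\<lambda>t. t ^ k) (affine_form (0, N) x)"
  have "?D \<in> function_space.span (positive_powers K k)"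
    by (rule iterated_difference_in_span_positive_powers) (use N in \<open>auto simp: affine_form_def\<close>)
  then have "(\<lambda>x. 1 / fact k * ?D x) \<in> function_space.span (positive_powers K k)"
    by (rule function_space.span_scale)
  then show ?thesis
    by (simp add: iterated_difference_power assms(2))
qed

lemma monomial_decrease:
  assumes "0 < \<alpha> i"
  shows "monomial \<alpha> x = x $ i * monomial (\<alpha>(i := \<alpha> i - 1)) x"
proof -
  have "(x $ i) ^ \<alpha> i = x $ i * (x $ i) ^ (\<alpha> i - 1)"
    using assms by (cases "\<alpha> i") auto
  moreover have "(\<Prod>j\<in>UNIV - {i}. (x $ j) ^ \<alpha> j) =
      (\<Prod>j\<in>UNIV - {i}. (x $ j) ^ (\<alpha>(i := \<alpha> i - 1)) j)"
    by (rule prod.cong) auto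
  ultimately show ?thesis
    by (simp add: monomial_def prod.remove[of UNIV i])
qed

lemma sum_decrease:
  fixes \<alpha> :: "'d::finite \<Rightarrow> nat"
  assumes "0 < \<alpha> i"
  shows "sum \<alpha> UNIV = Suc (sum (\<alpha>(i := \<alpha> i - 1)) UNIV)"
proof -
  have "sum \<alpha> (UNIV - {i}) = sum (\<alpha>(i := \<alpha> i - 1)) (UNIV - {i})"
    by (rule sum.cong) auto
  then show ?thesis using assms by (simp add: sum.remove[of UNIV i])
qed

text \<open>
  The factors are coordinates, padded by constant forms 1: polarization of \<open>k\<close>-th powers needs
  exactly \<open>k\<close> factors, whatever the degree of the monomial.
\<close>
lemma monomial_affine_product:
  assumes "\<alpha> \<in> multi_indices k"
  shows "\<exists>ls. length ls = k \<and> (\<forall>x. monomial \<alpha> x = prod_list (map (\<lambda>l. affine_form l x) ls))"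
  using assms
proof (induction k arbitrary: \<alpha>)
  case 0
  then have "\<alpha> i = 0" for i by (auto simp: multi_indices_def)
  then show ?case by (simp add: monomial_def)
next
  case (Suc k)
  show ?case
  proof (cases "sum \<alpha> UNIV \<le> k")
    case True
    then obtain ls where "length ls = k" "\<forall>x. monomial \<alpha> x = prod_list (map (\<lambda>l. affine_form l x) ls)"
      using Suc.IH[of \<alpha>] by (auto simp: multi_indices_def)
    then show ?thesis
      by (intro exI[of _ "(0, 1) # ls"]) (auto simp: affine_form_def)
  next
    case False
    then obtain i where i: "0 < \<alpha> i"
      by (metis gr0I le0 sum.neutral)
    have "\<alpha>(i := \<alpha> i - 1) \<in> multi_indices k"
      using Suc.prems sum_decrease[of \<alpha> i, OF i] by (auto simp: multi_indices_def)
    then obtain ls where "length ls = k"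
      "\<forall>x. monomial (\<alpha>(i := \<alpha> i - 1)) x = prod_list (map (\<lambda>l. affine_form l x) ls)"
      using Suc.IH by blast
    then show ?thesis
      by (intro exI[of _ "(axis i 1, 0) # ls"])
         (auto simp: affine_form_def inner_axis' monomial_decrease[of \<alpha> i, OF i])
  qed
qed

lemma monomials_subset_span_positive_powers:
  fixes K :: "(real ^ 'd) set"
  assumes "bounded K"
  shows "monomial ` multi_indices k \<subseteq> function_space.span (positive_powers K k)"
proof
  fix f :: "real ^ 'd \<Rightarrow> real"
  assume "f \<in> monomial ` multi_indices k"
  then obtain \<alpha> where \<alpha>: "\<alpha> \<in> multi_indices k" "f = monomial \<alpha>" by blast
  obtain ls where ls: "length ls = k" "\<forall>x. monomial \<alpha> x = prod_list (map (\<lambda>l. affine_form l x) ls)"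
    using monomial_affine_product[OF \<alpha>(1)] by blast
  have "f = (\<lambda>x. prod_list (map (\<lambda>l. affine_form l x) ls))"
    using \<alpha>(2) ls(2) by (simp add: fun_eq_iff)
  then show "f \<in> function_space.span (positive_powers K k)"
    using affine_product_in_span_positive_powers[OF assms ls(1)] by (simp only:)
qed

lemma coordinate_times_monomial:
  assumes "\<alpha> \<in> multi_indices k"
  shows "(\<lambda>x. x $ i * monomial \<alpha> x) \<in> monomial ` multi_indices (Suc k)"
proof -
  let ?\<beta> = "\<alpha>(i := Suc (\<alpha> i))"
  have "monomial ?\<beta> x = x $ i * monomial \<alpha> x" for x
    using monomial_decrease[of ?\<beta> i x] by simp
  moreover have "?\<beta> \<in> multi_indices (Suc k)"
    using assms sum_decrease[of ?\<beta> i] by (simp add: multi_indices_def)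
  ultimately show ?thesis by (intro image_eqI[of _ _ ?\<beta>] ext) simp_all
qed

text \<open>
  Induction over the span, since multiplication by a coordinate takes monomials to monomials
  and raises the degree by one.
\<close>
lemma affine_times_polynomial:
  assumes "f \<in> function_space.span (monomial ` multi_indices k)"
  shows "(\<lambda>x. affine_form l x * f x) \<in> function_space.span (monomial ` multi_indices (Suc k))"
  using assms
proof (induction rule: function_space.span_induct_alt)
  case base
  then show ?case
    using function_space.span_zero by (simp add: zero_fun_def)
next
  case (step c g f)
  then obtain \<alpha> where \<alpha>: "\<alpha> \<in> multi_indices k" "g = monomial \<alpha>" by blast
  let ?V = "function_space.span (monomial ` multi_indices (Suc k) :: (real ^ 'a \<Rightarrow> real) set)"
  have coord: "(\<lambda>x. (c * fst l $ i) * (x $ i * g x)) \<in> ?V" for i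
    using function_space.span_base[OF coordinate_times_monomial[OF \<alpha>(1), of i]] \<alpha>(2)
    by (intro function_space.span_scale) simp
  have "\<alpha> \<in> multi_indices (Suc k)" using \<alpha>(1) by (simp add: multi_indices_def)
  then have const: "(\<lambda>x. (c * snd l) * g x) \<in> ?V"
    using \<alpha>(2) by (intro function_space.span_scale function_space.span_base) simp
  let ?S = "(\<Sum>i\<in>UNIV. (\<lambda>x. (c * fst l $ i) * (x $ i * g x)))"
  have "?S + (\<lambda>x. (c * snd l) * g x) + (\<lambda>x. affine_form l x * f x) \<in> ?V"
    by (intro function_space.span_add function_space.span_sum coord const step)
  moreover have "?S + (\<lambda>x. (c * snd l) * g x) + (\<lambda>x. affine_form l x * f x) =
      (\<lambda>x. affine_form l x * ((\<lambda>x. c * g x) + f) x)"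
  proof
    fix y
    have "?S y = (\<Sum>i\<in>UNIV. (c * fst l $ i) * (y $ i * g y))"
      by (simp only: sum_fun_apply)
    also have "\<dots> = c * (fst l \<bullet> y) * g y"
      by (simp add: inner_vec_def sum_distrib_left sum_distrib_right mult.assoc)
    finally have S: "?S y = c * (fst l \<bullet> y) * g y" .
    show "(?S + (\<lambda>x. (c * snd l) * g x) + (\<lambda>x. affine_form l x * f x)) y =
        affine_form l y * ((\<lambda>x. c * g x) + f) y"
      unfolding plus_fun_apply S affine_form_def by (simp add: algebra_simps)
  qed
  ultimately show ?case by (simp only:)
qed

lemma positive_powers_subset_span_monomials:
  "positive_powers K k \<subseteq> function_space.span (monomial ` multi_indices k)"
proof -
  have "(\<lambda>x::real^'d. affine_form l x ^ k) \<in> function_space.span (monomial ` multi_indices k)" for l k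
  proof (induction k)
    case 0
    have "(\<lambda>x. 1) = (monomial (\<lambda>_. 0) :: real^'d \<Rightarrow> real)" by (simp add: monomial_def fun_eq_iff)
    then show ?case
      by (auto intro!: function_space.span_base simp: multi_indices_def)
  next
    case (Suc k)
    then show ?case using affine_times_polynomial[OF Suc, of l] by simp
  qed
  then show ?thesis unfolding positive_powers_def by blast
qed

text \<open>
  Prepending the slack \<open>k\<close> minus the degree turns a multi-index into a list of
  \<open>CARD('d) + 1\<close> naturals with sum exactly \<open>k\<close>, and these are counted by stars and bars.
\<close>
lemma card_multi_indices_le:
  "card (multi_indices k :: ('d::finite \<Rightarrow> nat) set) \<le> (CARD('d) + k) choose CARD('d)"
proof -
  obtain cs :: "'d list" where cs: "set cs = UNIV" "distinct cs"
    using finite_distinct_list[of "UNIV :: 'd set"] by auto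
  define n where "n = CARD('d)"
  have len: "length cs = n"
    using cs distinct_card[of cs] by (simp add: n_def)
  let ?list = "\<lambda>\<alpha>. (k - sum \<alpha> UNIV) # map \<alpha> cs"
  have "sum_list (map \<alpha> cs) = sum \<alpha> UNIV" for \<alpha> :: "'d \<Rightarrow> nat"
    using cs by (simp add: sum_list_distinct_conv_sum_set)
  then have "?list ` multi_indices k \<subseteq> {l. length l = Suc n \<and> sum_list l = k}"
    by (auto simp: len multi_indices_def)
  moreover have "inj_on ?list (multi_indices k)"
    using cs by (auto simp: inj_on_def fun_eq_iff)
  moreover have "finite {l::nat list. length l = Suc n \<and> sum_list l = k}"
  proof (rule finite_subset)
    show "{l::nat list. length l = Suc n \<and> sum_list l = k} \<subseteq> {l. set l \<subseteq> {..k} \<and> length l = Suc n}"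
      using member_le_sum_list by fastforce
  qed (simp add: finite_lists_length_eq)
  ultimately have "card (multi_indices k :: ('d \<Rightarrow> nat) set) \<le>
      card {l::nat list. length l = Suc n \<and> sum_list l = k}"
    by (meson card_inj_on_le)
  also have "\<dots> = (k + n) choose k"
    by (simp add: card_length_sum_list)
  also have "\<dots> = (n + k) choose n"
    using binomial_symmetric[of k "k + n"] by (simp add: add.commute)
  finally show ?thesis by (simp add: n_def)
qed

text \<open>
  A maximal independent set of \<open>k\<close>-th powers of positive affine forms still spans all
  polynomials of degree at most \<open>k\<close>. Since it lies in the span of the monomials, the exchange lemma
  bounds its size by their number. Positivity on \<open>K\<close> is what allows a rectified power unit to
  reproduce each of these powers without truncation.
\<close>
lemma positive_powers_basis:
  fixes K :: "(real ^ 'd) set"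
  assumes "bounded K"
  shows "\<exists>L. finite L \<and> card L \<le> (CARD('d) + k) choose CARD('d) \<and>
    (\<forall>l\<in>L. \<forall>x\<in>K. 0 < affine_form l x) \<and>
    (\<forall>p\<in>polys k. \<exists>q. \<forall>x. p x = (\<Sum>l\<in>L. q l * affine_form l x ^ k))"
proof -
  let ?G = "positive_powers K k" and ?Mon = "monomial ` multi_indices k :: (real ^ 'd \<Rightarrow> real) set"
  obtain B where B: "B \<subseteq> ?G" "function_space.independent B" "?G \<subseteq> function_space.span B"
    using function_space.maximal_independent_subset by blast
  have finMon: "finite ?Mon" by (simp add: finite_multi_indices)
  have cardMon: "card ?Mon \<le> (CARD('d) + k) choose CARD('d)"
    using card_image_le[OF finite_multi_indices] card_multi_indices_le by (rule order_trans)
  have finB: "finite B" "card B \<le> card ?Mon"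
    using function_space.independent_span_bound[OF finMon B(2)] B(1)
      positive_powers_subset_span_monomials by blast+
  have "\<forall>g\<in>B. \<exists>l. (\<forall>x\<in>K. 0 < affine_form l x) \<and> g = (\<lambda>x. affine_form l x ^ k)"
    using B(1) unfolding positive_powers_def by blast
  then obtain c where c: "\<And>g x. g \<in> B \<Longrightarrow> x \<in> K \<Longrightarrow> 0 < affine_form (c g) x"
    "\<And>g. g \<in> B \<Longrightarrow> (\<lambda>x. affine_form (c g) x ^ k) = g"
    by metis
  then have inj: "inj_on c B"
    by (intro inj_on_inverseI[of B "\<lambda>l x. affine_form l x ^ k"])
  show ?thesis
  proof (intro exI[of _ "c ` B"] conjI ballI)
    show "finite (c ` B)" using finB(1) by simp
    show "card (c ` B) \<le> (CARD('d) + k) choose CARD('d)"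
      using card_image_le[OF finB(1), of c] finB(2) cardMon by linarith
    show "0 < affine_form l x" if "l \<in> c ` B" "x \<in> K" for l x
      using that c(1) by blast
    fix p :: "real ^ 'd \<Rightarrow> real" assume "p \<in> polys k"
    then obtain a where a: "\<forall>x. p x = (\<Sum>\<alpha>\<in>multi_indices k. a \<alpha> * monomial \<alpha> x)"
      by (auto simp: polys_def)
    \<comment> \<open>through the span of all positive powers, which is the span of \<open>B\<close>\<close>
    have "?Mon \<subseteq> function_space.span B"
      using monomials_subset_span_positive_powers[OF assms, of k] B(3)
        function_space.span_minimal[OF B(3) function_space.subspace_span] by blast
    then have "(\<Sum>\<alpha>\<in>multi_indices k. (\<lambda>x. a \<alpha> * monomial \<alpha> x)) \<in> function_space.span B"
      by (intro function_space.span_sum function_space.span_scale) blast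
    then obtain r where r: "(\<Sum>\<alpha>\<in>multi_indices k. (\<lambda>x. a \<alpha> * monomial \<alpha> x)) = (\<Sum>g\<in>B. (\<lambda>x. r g * g x))"
      unfolding function_space.span_finite[OF finB(1)] by blast
    have "p x = (\<Sum>l\<in>c ` B. r (\<lambda>x. affine_form l x ^ k) * affine_form l x ^ k)" for x
    proof -
      have "p x = (\<Sum>g\<in>B. r g * g x)"
        using fun_cong[OF r, of x] a by (simp add: sum_fun_apply)
      also have "\<dots> = (\<Sum>g\<in>B. r (\<lambda>x. affine_form (c g) x ^ k) * affine_form (c g) x ^ k)"
      proof (rule sum.cong)
        fix g assume "g \<in> B"
        from c(2)[OF this] fun_cong[OF c(2)[OF this], of x]
        show "r g * g x = r (\<lambda>x. affine_form (c g) x ^ k) * affine_form (c g) x ^ k"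
          by (simp only:)
      qed simp
      finally show ?thesis by (simp add: sum.reindex[OF inj])
    qed
    then show "\<exists>q. \<forall>x. p x = (\<Sum>l\<in>c ` B. q l * affine_form l x ^ k)"
      by (intro exI[of _ "\<lambda>l. r (\<lambda>x. affine_form l x ^ k)"]) blast
  qed
qed

section \<open>Open simplices as intersections of sides of hyperplanes\<close>

definition facet_planes :: "'a::euclidean_space set \<Rightarrow> 'a set set" where
  "facet_planes \<tau> = {affine hull F | F. F facet_of closure \<tau>}"

lemma facet_hyperplanes_eq: "facet_hyperplanes \<T> = (\<Union>\<tau>\<in>\<T>. facet_planes \<tau>)"
  by (auto simp: facet_hyperplanes_def facet_planes_def)

text \<open>
  A facet hyperplane shared by several elements gets one equation for the whole mesh, while each
  element comes with its own system of inequalities; this lemma translates between the two.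
\<close>
lemma hyperplane_equation_unique:
  fixes a a' :: "'a::real_inner"
  assumes "a \<noteq> 0" and eq: "{x. a \<bullet> x = b} = {x. a' \<bullet> x = b'}"
  obtains c where "a' = c *\<^sub>R a" "b' = c * b"
proof -
  define x0 where "x0 = (b / (a \<bullet> a)) *\<^sub>R a"
  define c where "c = (a' \<bullet> a) / (a \<bullet> a)"
  define y where "y = a' - c *\<^sub>R a"
  have ay: "a \<bullet> y = 0"
    using assms(1) by (simp add: y_def c_def inner_diff_right inner_commute)
  have x0: "a \<bullet> x0 = b" "a \<bullet> (x0 + y) = b"
    using assms(1) ay by (simp_all add: x0_def inner_add_right)
  then have x0': "a' \<bullet> x0 = b'" "a' \<bullet> (x0 + y) = b'"
    using eq by blast+
  then have "a' \<bullet> y = 0" by (simp add: inner_add_right)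
  then have "y \<bullet> y = 0"
    using ay by (simp add: y_def inner_diff_left)
  then have "a' = c *\<^sub>R a" by (simp add: y_def)
  moreover from this have "b' = c * b" using x0'(1) x0(1) by auto
  ultimately show thesis by (rule that)
qed

lemma open_simplex_properties:
  fixes \<tau> :: "'a::euclidean_space set"
  assumes "open_simplex \<tau>"
  shows "open \<tau>" "bounded \<tau>" "\<tau> \<noteq> {}" "polytope (closure \<tau>)" "\<tau> = rel_interior (closure \<tau>)"
    "affine hull closure \<tau> = UNIV"
proof -
  obtain S where S: "int DIM('a) simplex S" "\<tau> = interior S"
    using assms by (auto simp: open_simplex_def)
  have poly: "polytope S" using S(1) simplex_imp_polytope by blast
  have aff: "affine hull S = UNIV"
    using aff_dim_simplex[OF S(1)] aff_dim_eq_full by blast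
  have rel: "rel_interior S = interior S" using aff by (rule rel_interior_interior)
  have conv: "convex S" using poly by (rule polytope_imp_convex)
  have "S \<noteq> {}" using aff by auto
  then show ne: "\<tau> \<noteq> {}"
    using rel rel_interior_eq_empty[OF conv] S(2) by simp
  have cl: "closure \<tau> = S"
    using convex_closure_interior[OF conv] ne S(2) polytope_imp_closed[OF poly] by simp
  show "open \<tau>" using S(2) by simp
  show "bounded \<tau>"
    using polytope_imp_bounded[OF poly] bounded_subset interior_subset S(2) by blast
  show "polytope (closure \<tau>)" "\<tau> = rel_interior (closure \<tau>)" "affine hull closure \<tau> = UNIV"
    using cl poly rel S(2) aff by simp_all
qed

lemma finite_facet_planes:
  assumes "open_simplex \<tau>"
  shows "finite (facet_planes \<tau>)"
proof -
  have "facet_planes \<tau> = (\<lambda>F. affine hull F) ` {F. F facet_of closure \<tau>}"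
    by (auto simp: facet_planes_def)
  then show ?thesis
    using finite_polytope_facets[OF open_simplex_properties(4)[OF assms]] by simp
qed

text \<open>
  In a minimal halfspace description of the closed simplex, the facets are exactly the intersections with
  the bounding hyperplanes, and strict inequalities describe the interior. A facet has the dimension
  of its hyperplane, so it spans it.
\<close>
lemma open_simplex_halfspaces:
  fixes \<tau> :: "'a::euclidean_space set"
  assumes "open_simplex \<tau>"
  obtains F :: "'a set set" and a b where
    "\<forall>h\<in>F. a h \<noteq> 0"
    "\<tau> = {x. \<forall>h\<in>F. a h \<bullet> x < b h}"
    "facet_planes \<tau> = (\<lambda>h. {x. a h \<bullet> x = b h}) ` F"
proof -
  let ?S = "closure \<tau>"
  note basic = open_simplex_properties[OF assms]
  have "polyhedron ?S" using basic(4) polytope_imp_polyhedron by blast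
  then obtain F where F: "finite F" "?S = (affine hull ?S) \<inter> \<Inter>F"
    "\<forall>h\<in>F. \<exists>a b. a \<noteq> 0 \<and> h = {x. a \<bullet> x \<le> b}"
    "\<And>F'. F' \<subset> F \<Longrightarrow> ?S \<subset> (affine hull ?S) \<inter> \<Inter>F'"
    unfolding polyhedron_Int_affine_minimal by blast
  obtain a b where ab: "\<And>h. h \<in> F \<Longrightarrow> a h \<noteq> 0 \<and> h = {x. a h \<bullet> x \<le> b h}"
    using F(3) by metis
  have "rel_interior ?S = {x \<in> ?S. \<forall>h\<in>F. a h \<bullet> x < b h}"
    by (rule rel_interior_polyhedron_explicit[OF F(1,2) ab F(4)])
  moreover have "x \<in> ?S" if "\<forall>h\<in>F. a h \<bullet> x < b h" for x
  proof -
    have "x \<in> h" if h: "h \<in> F" for h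
    proof -
      have "x \<in> {x. a h \<bullet> x \<le> b h}" using \<open>\<forall>h\<in>F. a h \<bullet> x < b h\<close> h by (simp add: less_imp_le)
      then show ?thesis using ab[OF h] by blast
    qed
    then show ?thesis using F(2) basic(6) by blast
  qed
  ultimately have \<tau>: "\<tau> = {x. \<forall>h\<in>F. a h \<bullet> x < b h}"
    using basic(5) by auto
  have facet: "C facet_of ?S \<longleftrightarrow> (\<exists>h. h \<in> F \<and> C = ?S \<inter> {x. a h \<bullet> x = b h})" for C
    by (rule facet_of_polyhedron_explicit[OF F(1,2) ab F(4)])
  have hull: "affine hull (?S \<inter> {x. a h \<bullet> x = b h}) = {x. a h \<bullet> x = b h}" if "h \<in> F" for h
  proof (rule affine_dim_equal)
    let ?C = "?S \<inter> {x. a h \<bullet> x = b h}"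
    have C: "?C facet_of ?S" using facet that by blast
    then show "affine hull ?C \<noteq> {}" by (auto simp: facet_of_def)
    show "affine hull ?C \<subseteq> {x. a h \<bullet> x = b h}"
      by (rule hull_minimal) (auto simp: affine_hyperplane)
    have "aff_dim ?S = DIM('a)" using basic(6) aff_dim_eq_full by blast
    then show "aff_dim (affine hull ?C) = aff_dim {x. a h \<bullet> x = b h}"
      using C ab[OF that] by (simp add: facet_of_def aff_dim_hyperplane)
  qed (auto simp: affine_hyperplane)
  have "facet_planes \<tau> = (\<lambda>h. affine hull (?S \<inter> {x. a h \<bullet> x = b h})) ` F"
    unfolding facet_planes_def facet by blast
  also have "\<dots> = (\<lambda>h. {x. a h \<bullet> x = b h}) ` F"
    using hull by (intro image_cong) auto
  finally show thesis
    using that ab \<tau> by blast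
qed

lemma facet_plane_is_hyperplane:
  fixes \<tau> :: "'a::euclidean_space set"
  assumes "open_simplex \<tau>" "H \<in> facet_planes \<tau>"
  shows "\<exists>a b. a \<noteq> 0 \<and> H = {x. a \<bullet> x = b}"
proof -
  obtain F :: "'a set set" and a b where "\<forall>h\<in>F. a h \<noteq> 0"
    "\<tau> = {x. \<forall>h\<in>F. a h \<bullet> x < b h}"
    "facet_planes \<tau> = (\<lambda>h. {x. a h \<bullet> x = b h}) ` F"
    using open_simplex_halfspaces[OF assms(1)] by blast
  then show ?thesis using assms(2) by blast
qed

text \<open>
  The equations \<open>a H \<bullet> x = b H\<close> are prescribed and need not be oriented towards \<open>\<tau>\<close>;
  the flag \<open>s H\<close> records on which side of \<open>H\<close> the simplex lies.
\<close>
lemma open_simplex_sides: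
  fixes \<tau> :: "'a::euclidean_space set"
  assumes "open_simplex \<tau>"
    and ab: "\<And>H. H \<in> facet_planes \<tau> \<Longrightarrow> a H \<noteq> 0 \<and> H = {x. a H \<bullet> x = b H}"
  shows "\<exists>s::'a set \<Rightarrow> bool. \<tau> = {x. \<forall>H\<in>facet_planes \<tau>. if s H then b H < a H \<bullet> x else a H \<bullet> x < b H}"
proof -
  obtain F :: "'a set set" and a' b' where F: "\<forall>h\<in>F. a' h \<noteq> 0"
    "\<tau> = {x. \<forall>h\<in>F. a' h \<bullet> x < b' h}"
    "facet_planes \<tau> = (\<lambda>h. {x. a' h \<bullet> x = b' h}) ` F"
    using open_simplex_halfspaces[OF assms(1)] by blast
  obtain z where z: "z \<in> \<tau>" using open_simplex_properties(3)[OF assms(1)] by blast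
  define s where "s H \<longleftrightarrow> b H < a H \<bullet> z" for H
  have same: "a' h \<bullet> x < b' h \<longleftrightarrow> (if s H then b H < a H \<bullet> x else a H \<bullet> x < b H)"
    if h: "h \<in> F" and H: "H = {x. a' h \<bullet> x = b' h}" for h H x
  proof -
    have "H \<in> facet_planes \<tau>" using F(3) h H by blast
    then have aH: "a H \<noteq> 0" "{x. a H \<bullet> x = b H} = {x. a' h \<bullet> x = b' h}"
      using ab H by auto
    obtain c where c: "a' h = c *\<^sub>R a H" "b' h = c * b H"
      using hyperplane_equation_unique[OF aH] .
    have side: "a' h \<bullet> y < b' h \<longleftrightarrow> c * (a H \<bullet> y - b H) < 0" for y
      by (simp add: c algebra_simps)
    have "c * (a H \<bullet> z - b H) < 0" using z F(2) h side by blast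
    then show ?thesis unfolding side s_def
      by (auto simp: mult_less_0_iff)
  qed
  have "(\<forall>H\<in>facet_planes \<tau>. if s H then b H < a H \<bullet> x else a H \<bullet> x < b H) \<longleftrightarrow>
      (\<forall>h\<in>F. a' h \<bullet> x < b' h)" for x
    unfolding F(3) ball_simps by (intro ball_cong refl same[OF _ refl, symmetric])
  then have "\<tau> = {x. \<forall>H\<in>facet_planes \<tau>. if s H then b H < a H \<bullet> x else a H \<bullet> x < b H}"
    using F(2) by (simp only:)
  then show ?thesis by blast
qed

text \<open>
  A vector orthogonal to all normals could be added to a point of the cell any number of times
  without leaving the cell, which contradicts boundedness.
\<close>
lemma bounded_cell_normals_span:
  fixes a :: "'h \<Rightarrow> 'a::euclidean_space"
  assumes "bounded \<tau>" "\<tau> \<noteq> {}"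
    and \<tau>: "\<tau> = {x. \<forall>H\<in>F. if s H then b H < a H \<bullet> x else a H \<bullet> x < b H}"
  shows "span (a ` F) = UNIV"
proof (rule ccontr)
  assume "span (a ` F) \<noteq> UNIV"
  then obtain w where w: "w \<noteq> 0" "\<And>x. x \<in> span (a ` F) \<Longrightarrow> w \<bullet> x = 0"
    using span_not_UNIV_orthogonal by blast
  then have orth: "a H \<bullet> w = 0" if "H \<in> F" for H
    using that by (metis imageI inner_commute span_base)
  obtain z where z: "z \<in> \<tau>" using assms(2) by blast
  \<comment> \<open>the whole line through \<open>z\<close> in direction \<open>w\<close> lies in the cell\<close>
  have line: "z + t *\<^sub>R w \<in> \<tau>" for t
  proof -
    have "a H \<bullet> (z + t *\<^sub>R w) = a H \<bullet> z" if "H \<in> F" for H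
      using orth[OF that] by (simp add: inner_add_right)
    then show ?thesis using z unfolding \<tau> by simp
  qed
  obtain R where R: "\<And>x. x \<in> \<tau> \<Longrightarrow> norm x \<le> R"
    using assms(1) unfolding bounded_iff by blast
  \<comment> \<open>far enough to leave the ball of radius \<open>R\<close>\<close>
  define t where "t = (R + norm z + 1) / norm w"
  have Rz: "norm z \<le> R" using R z by blast
  then have "R \<ge> 0" using norm_ge_zero order_trans by blast
  then have "norm (t *\<^sub>R w) = R + norm z + 1"
    using w(1) by (simp add: t_def add_nonneg_nonneg)
  moreover have "norm (t *\<^sub>R w) \<le> norm (z + t *\<^sub>R w) + norm z"
    using norm_triangle_ineq4[of "z + t *\<^sub>R w" z] by simp
  ultimately show False using R[OF line[of t]] by linarith
qed

lemma mesh_cover: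
  assumes "conforming_mesh \<Omega> \<T>"
  shows "closure \<Omega> \<subseteq> \<Union>\<T> \<union> skeleton \<T>"
proof -
  have "closure \<tau> \<subseteq> \<tau> \<union> frontier \<tau>" for \<tau> :: "'a set"
    unfolding frontier_def using interior_subset by blast
  moreover have "closure \<Omega> = (\<Union>\<tau>\<in>\<T>. closure \<tau>)"
    using assms by (simp add: conforming_mesh_def)
  ultimately show ?thesis unfolding skeleton_def by blast
qed

text \<open>
  An open set disjoint from an element is also disjoint from its closure, so elements never meet
  the boundary of another element.
\<close>
lemma mesh_element_disjoint_skeleton:
  assumes mesh: "conforming_mesh \<Omega> \<T>" and \<tau>: "\<tau> \<in> \<T>"
  shows "\<tau> \<inter> skeleton \<T> = {}"
proof -
  have op: "open \<tau>" using mesh \<tau> open_simplex_properties(1) by (auto simp: conforming_mesh_def)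
  have "\<tau> \<inter> frontier \<tau>' = {}" if \<tau>': "\<tau>' \<in> \<T>" for \<tau>'
  proof (cases "\<tau>' = \<tau>")
    case True
    then show ?thesis using op by (auto simp: frontier_def interior_open)
  next
    case False
    then have "\<tau> \<inter> \<tau>' = {}"
      using mesh \<tau> \<tau>' by (auto simp: conforming_mesh_def pairwise_def disjnt_def)
    then have "\<tau> \<inter> closure \<tau>' = {}" using op open_Int_closure_eq_empty by blast
    then show ?thesis by (auto simp: frontier_def)
  qed
  then show ?thesis by (auto simp: skeleton_def)
qed

lemma in_span_image_finite:
  fixes a :: "'h \<Rightarrow> 'v::real_vector"
  assumes "finite F" "w \<in> span (a ` F)"
  shows "\<exists>u. w = (\<Sum>H\<in>F. u H *\<^sub>R a H)"
  using assms
proof (induction F arbitrary: w rule: finite_induct)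
  case (insert H F)
  then obtain c where "w - c *\<^sub>R a H \<in> span (a ` F)"
    by (auto simp: span_breakdown_eq)
  then obtain u where u: "w - c *\<^sub>R a H = (\<Sum>H\<in>F. u H *\<^sub>R a H)"
    using insert.IH by blast
  have "(\<Sum>G\<in>F. (u(H := c)) G *\<^sub>R a G) = (\<Sum>G\<in>F. u G *\<^sub>R a G)"
    using insert.hyps(2) by (intro sum.cong) auto
  then have "w = (\<Sum>G\<in>insert H F. (u(H := c)) G *\<^sub>R a G)"
    using insert.hyps u by (simp add: algebra_simps)
  then show ?case by blast
qed auto

section \<open>Gated neurons\<close>

text \<open>
  Two neurons per hyperplane, one for each orientation. A coefficient can be chosen separately for
  each orientation, and the weights and biases serve all activations \<open>\<rho>\<close> at once.
\<close>
lemma first_layer: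
  fixes a :: "'h \<Rightarrow> real ^ 'd"
  assumes "finite \<H>"
  shows "\<exists>W b'. \<forall>c :: 'h \<Rightarrow> bool \<Rightarrow> real. \<exists>r. \<forall>\<rho> x.
       (\<Sum>i<2 * card \<H>. r i * \<rho> (W i \<bullet> x + b' i)) =
       (\<Sum>H\<in>\<H>. c H True * \<rho> (a H \<bullet> x - b H) + c H False * \<rho> (b H - a H \<bullet> x) :: real)"
proof -
  have "card (\<H> \<times> (UNIV :: bool set)) = 2 * card \<H>"
    by (simp add: card_cartesian_product mult.commute)
  then obtain \<psi> where \<psi>: "bij_betw \<psi> {..<2 * card \<H>} (\<H> \<times> (UNIV :: bool set))"
    using ex_bij_betw_nat_finite[of "\<H> \<times> (UNIV :: bool set)"] assms
    by (auto simp: atLeast0LessThan mult.commute)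
  define W where "W i = (case \<psi> i of (H, \<sigma>) \<Rightarrow> if \<sigma> then a H else - a H)" for i
  define b' where "b' i = (case \<psi> i of (H, \<sigma>) \<Rightarrow> if \<sigma> then - b H else b H)" for i
  have sums: "(\<Sum>i<2 * card \<H>. (case \<psi> i of (H, \<sigma>) \<Rightarrow> c H \<sigma>) * \<rho> (W i \<bullet> x + b' i)) =
       (\<Sum>H\<in>\<H>. c H True * \<rho> (a H \<bullet> x - b H) + c H False * \<rho> (b H - a H \<bullet> x))"
    for c :: "'h \<Rightarrow> bool \<Rightarrow> real" and \<rho> x
  proof -
    let ?g = "\<lambda>H \<sigma>. c H \<sigma> * \<rho> (if \<sigma> then a H \<bullet> x - b H else b H - a H \<bullet> x)"
    have "(\<Sum>i<2 * card \<H>. (case \<psi> i of (H, \<sigma>) \<Rightarrow> c H \<sigma>) * \<rho> (W i \<bullet> x + b' i)) =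
        (\<Sum>i<2 * card \<H>. (case \<psi> i of (H, \<sigma>) \<Rightarrow> ?g H \<sigma>))"
      by (intro sum.cong) (auto simp: W_def b'_def split: prod.split)
    also have "\<dots> = (\<Sum>(H, \<sigma>)\<in>\<H> \<times> UNIV. ?g H \<sigma>)"
      by (rule sum.reindex_bij_betw[OF \<psi>])
    also have "\<dots> = (\<Sum>H\<in>\<H>. \<Sum>\<sigma>\<in>UNIV. ?g H \<sigma>)"
      by (rule sum.cartesian_product[symmetric])
    finally show ?thesis by (simp add: UNIV_bool add.commute)
  qed
  show ?thesis
    by (rule exI[of _ W], rule exI[of _ b'], intro allI, rule exI, intro allI, rule sums)
qed

text \<open>
  With \<open>max t 0 - max (- t) 0 = t\<close> this makes every affine form available after the first layer.
\<close>
lemma affine_form_from_spanning_normals: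
  fixes a :: "'h \<Rightarrow> 'a::real_inner"
  assumes "finite \<H>" "span (a ` \<H>) = UNIV"
  shows "\<exists>u \<gamma>. \<forall>x. affine_form l x = (\<Sum>H\<in>\<H>. u H * (a H \<bullet> x - b H)) + \<gamma>"
proof -
  obtain u where u: "fst l = (\<Sum>H\<in>\<H>. u H *\<^sub>R a H)"
    using in_span_image_finite[OF assms(1), of "fst l" a] assms(2) by auto
  have "affine_form l x = (\<Sum>H\<in>\<H>. u H * (a H \<bullet> x - b H)) + ((\<Sum>H\<in>\<H>. u H * b H) + snd l)" for x
    by (simp add: affine_form_def u inner_sum_left right_diff_distrib sum_subtractf)
  then show ?thesis by blast
qed

text \<open>
  The gate: each violated condition costs \<open>B\<close>, which is at least the positive value \<open>t\<close>. So one
  violation makes the argument nonpositive, and no violation leaves it equal to \<open>t\<close>. For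
  \<open>k = 0\<close> the activation vanishes at 0 and the convention \<open>t ^ 0 = 1\<close> matches its value at
  positive arguments, so both kinds of activation are covered.
\<close>
lemma rho_gate:
  fixes t B :: real
  assumes "finite F" "0 < t" "t \<le> B"
  shows "rho k (t + B * (\<Sum>H\<in>F. of_bool (P H)) - B * card F) =
    (if \<forall>H\<in>F. P H then t ^ k else 0)"
proof (cases "\<forall>H\<in>F. P H")
  case True
  then show ?thesis using assms(2) by (simp add: rho_def)
next
  case False
  then have "{H \<in> F. P H} \<subset> F" by blast
  then have "card {H \<in> F. P H} < card F" using assms(1) by (rule psubset_card_mono[rotated])
  then have "real (card {H \<in> F. P H}) + 1 \<le> card F" by linarith
  then have "B * (real (card {H \<in> F. P H}) + 1) \<le> B * card F"
    using assms(2,3) by (intro mult_left_mono) auto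
  moreover have "(\<Sum>H\<in>F. of_bool (P H)) = real (card {H \<in> F. P H})"
    using assms(1) by (simp add: sum_of_bool_eq Int_def)
  ultimately have "t + B * (\<Sum>H\<in>F. of_bool (P H)) - B * card F \<le> 0"
    using assms(3) by (simp add: algebra_simps)
  then show ?thesis unfolding if_not_P[OF False] by (simp add: rho_def)
qed

text \<open>
  One neuron of the second layer for each pair of an element \<open>\<tau>\<close> and an affine form \<open>l\<close>. Its
  argument combines the affine form, obtained from the linear rectifiers, with the Heaviside
  units that test the sides of the hyperplanes in \<open>F \<tau>\<close>. The quantifier over the
  output coefficients \<open>q\<close> comes after the hidden parameters.
\<close>
lemma gated_hidden_layers:
  fixes a :: "'h \<Rightarrow> real ^ 'd" and L :: "((real ^ 'd) \<times> real) set"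
    and F :: "'t \<Rightarrow> 'h set"
  assumes fin: "finite \<H>" "finite \<T>" "finite L"
    and sub: "\<forall>\<tau>\<in>\<T>. F \<tau> \<subseteq> \<H>"
    and span: "span (a ` \<H>) = UNIV"
    and K: "bounded K" "\<forall>l\<in>L. \<forall>x\<in>K. 0 < affine_form l x"
    and n2: "card L * card \<T> \<le> n2"
  shows "\<exists>(W1 :: nat \<Rightarrow> real ^ 'd) b1 W20 W21 b2. \<forall>q. \<exists>W3 :: 'm::finite \<Rightarrow> nat \<Rightarrow> real. \<forall>m. \<forall>x\<in>K.
       network k (2 * card \<H>) n2 W1 b1 W20 W21 b2 W3 x $ m =
       (\<Sum>\<tau>\<in>\<T>. \<Sum>l\<in>L. q \<tau> l *
          (if \<forall>H\<in>F \<tau>. if s \<tau> H then b H < a H \<bullet> x else a H \<bullet> x < b H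
           then affine_form l x ^ k else 0))"
proof -
  obtain W1 b1 where layer: "\<And>c :: 'h \<Rightarrow> bool \<Rightarrow> real. \<exists>r. \<forall>\<rho> x.
       (\<Sum>i<2 * card \<H>. r i * \<rho> (W1 i \<bullet> x + b1 i)) =
       (\<Sum>H\<in>\<H>. c H True * \<rho> (a H \<bullet> x - b H) + c H False * \<rho> (b H - a H \<bullet> x) :: real)"
    using first_layer[OF fin(1), of a b] by blast
  have "\<forall>l. \<exists>u \<gamma>. \<forall>x. affine_form l x = (\<Sum>H\<in>\<H>. u H * (a H \<bullet> x - b H)) + \<gamma>"
    using affine_form_from_spanning_normals[OF fin(1) span] by blast
  then obtain u \<gamma> where u: "\<And>l x. affine_form l x = (\<Sum>H\<in>\<H>. u l H * (a H \<bullet> x - b H)) + \<gamma> l"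
    by metis
  obtain ls where ls: "set ls = L" using fin(3) finite_list by blast
  obtain B where B: "\<forall>x\<in>K. (\<Sum>l\<leftarrow>ls. \<bar>affine_form l x\<bar>) < B"
    using affine_forms_bounded[OF K(1)] by blast
  have bound: "affine_form l x \<le> B" if "l \<in> L" "x \<in> K" for l x
  proof -
    have "\<bar>affine_form l x\<bar> \<le> (\<Sum>l\<leftarrow>ls. \<bar>affine_form l x\<bar>)"
      using that(1) ls by (intro member_le_sum_list) auto
    also have "\<dots> < B" using B that(2) by blast
    finally show ?thesis by linarith
  qed
  let ?P = "\<lambda>\<tau> H x. if s \<tau> H then b H < a H \<bullet> x else a H \<bullet> x < b H"
  \<comment> \<open>the Heaviside unit that is active on the inner side of each hyperplane of \<open>\<tau>\<close>\<close>
  define g where "g \<tau> H \<sigma> = (if H \<in> F \<tau> \<and> (s \<tau> H \<longleftrightarrow> \<sigma>) then B else 0)" for \<tau> H \<sigma>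
  have "\<forall>\<tau>. \<exists>r. \<forall>\<rho> x. (\<Sum>i<2 * card \<H>. r i * \<rho> (W1 i \<bullet> x + b1 i)) =
       (\<Sum>H\<in>\<H>. g \<tau> H True * \<rho> (a H \<bullet> x - b H) + g \<tau> H False * \<rho> (b H - a H \<bullet> x))"
    by (intro allI layer)
  from choice[OF this] obtain r0 where r0: "\<And>\<tau> \<rho> x.
       (\<Sum>i<2 * card \<H>. r0 \<tau> i * \<rho> (W1 i \<bullet> x + b1 i)) =
       (\<Sum>H\<in>\<H>. g \<tau> H True * \<rho> (a H \<bullet> x - b H) + g \<tau> H False * \<rho> (b H - a H \<bullet> x))"
    by blast
  \<comment> \<open>the difference of the two rectifiers at \<open>H\<close> is the signed value of its equation\<close>
  define e where "e l H \<sigma> = (if \<sigma> then u l H else - u l H)" for l H \<sigma>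
  have "\<forall>l. \<exists>r. \<forall>\<rho> x. (\<Sum>i<2 * card \<H>. r i * \<rho> (W1 i \<bullet> x + b1 i)) =
       (\<Sum>H\<in>\<H>. e l H True * \<rho> (a H \<bullet> x - b H) + e l H False * \<rho> (b H - a H \<bullet> x))"
    by (intro allI layer)
  from choice[OF this] obtain r1 where r1: "\<And>l \<rho> x.
       (\<Sum>i<2 * card \<H>. r1 l i * \<rho> (W1 i \<bullet> x + b1 i)) =
       (\<Sum>H\<in>\<H>. e l H True * \<rho> (a H \<bullet> x - b H) + e l H False * \<rho> (b H - a H \<bullet> x))"
    by blast
  have gate: "(\<Sum>i<2 * card \<H>. r0 \<tau> i * rho 0 (W1 i \<bullet> x + b1 i)) =
      B * (\<Sum>H\<in>F \<tau>. of_bool (?P \<tau> H x))" if "\<tau> \<in> \<T>" for \<tau> x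
  proof -
    have "(\<Sum>i<2 * card \<H>. r0 \<tau> i * rho 0 (W1 i \<bullet> x + b1 i)) =
        (\<Sum>H\<in>\<H>. if H \<in> F \<tau> then B * of_bool (?P \<tau> H x) else 0)"
      unfolding r0 by (intro sum.cong) (auto simp: g_def rho_def)
    also have "\<dots> = (\<Sum>H\<in>F \<tau>. B * of_bool (?P \<tau> H x))"
      using bspec[OF sub that] fin(1) by (simp add: sum.inter_restrict[symmetric] Int_absorb1)
    finally show ?thesis by (simp add: sum_distrib_left)
  qed
  have lin: "(\<Sum>i<2 * card \<H>. r1 l i * rho 1 (W1 i \<bullet> x + b1 i)) + \<gamma> l = affine_form l x" for l x
    unfolding r1 u by (intro arg_cong2[of _ _ _ _ "(+)"] sum.cong)
      (auto simp: e_def rho_def max_def algebra_simps)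
  let ?n = "card (\<T> \<times> L)"
  have n: "?n \<le> n2" using n2 by (simp add: card_cartesian_product mult.commute)
  obtain \<phi> where \<phi>: "bij_betw \<phi> {..<?n} (\<T> \<times> L)"
    using ex_bij_betw_nat_finite[of "\<T> \<times> L"] fin by (auto simp: atLeast0LessThan)
  define W20 where "W20 j = r0 (fst (\<phi> j))" for j
  define W21 where "W21 j = r1 (snd (\<phi> j))" for j
  define b2 where "b2 j = \<gamma> (snd (\<phi> j)) - B * card (F (fst (\<phi> j)))" for j
  show ?thesis
  proof (rule exI[of _ W1], rule exI[of _ b1], rule exI[of _ W20], rule exI[of _ W21],
      rule exI[of _ b2], rule allI)
    fix q :: "'t \<Rightarrow> (real ^ 'd) \<times> real \<Rightarrow> real"
    \<comment> \<open>neurons beyond the pairs of elements and forms are switched off\<close>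
    define W3 where "W3 m j = (if j < ?n then q (fst (\<phi> j)) (snd (\<phi> j)) else 0)" for m :: 'm and j
    have "network k (2 * card \<H>) n2 W1 b1 W20 W21 b2 W3 x $ m =
       (\<Sum>\<tau>\<in>\<T>. \<Sum>l\<in>L. q \<tau> l * (if \<forall>H\<in>F \<tau>. ?P \<tau> H x then affine_form l x ^ k else 0))"
      if x: "x \<in> K" for m x
    proof -
      let ?h = "\<lambda>j. rho k ((\<Sum>i<2 * card \<H>. W20 j i * rho 0 (W1 i \<bullet> x + b1 i)) +
               (\<Sum>i<2 * card \<H>. W21 j i * rho 1 (W1 i \<bullet> x + b1 i)) + b2 j)"
      let ?G = "\<lambda>\<tau> l. q \<tau> l * (if \<forall>H\<in>F \<tau>. ?P \<tau> H x then affine_form l x ^ k else 0)"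
      have h: "q \<tau> l * ?h j = ?G \<tau> l" if "j < ?n" "\<phi> j = (\<tau>, l)" for j \<tau> l
      proof -
        have "\<phi> j \<in> \<T> \<times> L" using bij_betwE[OF \<phi>] that(1) by blast
        then have mem: "\<tau> \<in> \<T>" "l \<in> L" by (simp_all add: that(2))
        have "finite (F \<tau>)" using bspec[OF sub mem(1)] fin(1) finite_subset by blast
        from rho_gate[OF this K(2)[rule_format, OF mem(2) x] bound[OF mem(2) x], of k "\<lambda>H. ?P \<tau> H x"]
        show ?thesis
          using gate[OF mem(1), of x] lin[of l x, symmetric] that(2)
          by (simp add: W20_def W21_def b2_def algebra_simps)
      qed
      have "network k (2 * card \<H>) n2 W1 b1 W20 W21 b2 W3 x $ m = (\<Sum>j<n2. W3 m j * ?h j)"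
        by (simp add: network_def)
      also have "\<dots> = (\<Sum>j<?n. W3 m j * ?h j)"
        using n by (intro sum.mono_neutral_right) (auto simp: W3_def)
      also have "\<dots> = (\<Sum>j<?n. (case \<phi> j of (\<tau>, l) \<Rightarrow> ?G \<tau> l))"
      proof (rule sum.cong)
        fix j assume "j \<in> {..<?n}"
        then show "W3 m j * ?h j = (case \<phi> j of (\<tau>, l) \<Rightarrow> ?G \<tau> l)"
          using h[of j "fst (\<phi> j)" "snd (\<phi> j)"] by (simp add: W3_def case_prod_unfold)
      qed simp
      also have "\<dots> = (\<Sum>(\<tau>, l)\<in>\<T> \<times> L. ?G \<tau> l)"
        by (rule sum.reindex_bij_betw[OF \<phi>])
      finally show ?thesis by (simp only: sum.cartesian_product)
    qed
    then show "\<exists>W3 :: 'm \<Rightarrow> nat \<Rightarrow> real. \<forall>m. \<forall>x\<in>K. network k (2 * card \<H>) n2 W1 b1 W20 W21 b2 W3 x $ m =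
       (\<Sum>\<tau>\<in>\<T>. \<Sum>l\<in>L. q \<tau> l * (if \<forall>H\<in>F \<tau>. ?P \<tau> H x then affine_form l x ^ k else 0))"
      by blast
  qed
qed

theorem theorem4:
  fixes \<Omega> :: "(real ^ 'd) set" and \<T> :: "(real ^ 'd) set set" and k M :: nat
  assumes "open_polyhedral \<Omega>"
    and "conforming_mesh \<Omega> \<T>"
    and "M = (CARD('d) + k) choose CARD('d)"
  shows "(\<forall>v\<in>DG0 k \<T>.
            \<exists>f\<in>(NN k (2 * card (facet_hyperplanes \<T>)) (M * card \<T>) :: (real ^ 'd \<Rightarrow> real ^ 1) set).
              \<forall>x\<in>closure \<Omega>. v x = f x $ 1) \<and>
         (\<exists>(W1 :: nat \<Rightarrow> real ^ 'd) b1 W20 W21 b2. \<forall>v\<in>DG0 k \<T>. \<exists>W3 :: 1 \<Rightarrow> nat \<Rightarrow> real.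
            \<forall>x\<in>closure \<Omega>.
              v x = network k (2 * card (facet_hyperplanes \<T>)) (M * card \<T>)
                      W1 b1 W20 W21 b2 W3 x $ 1)"
proof -
  let ?\<H> = "facet_hyperplanes \<T>"
  have "\<exists>(W1 :: nat \<Rightarrow> real ^ 'd) b1 W20 W21 b2. \<forall>v\<in>DG0 k \<T>. \<exists>W3 :: 1 \<Rightarrow> nat \<Rightarrow> real.
      \<forall>x\<in>closure \<Omega>. v x = network k (2 * card ?\<H>) (M * card \<T>) W1 b1 W20 W21 b2 W3 x $ 1"
  proof (cases "\<T> = {}")
    case True
    then have "closure \<Omega> = {}" using assms(2) by (auto simp: conforming_mesh_def)
    then show ?thesis by simp
  next
    case False
    have simplices: "open_simplex \<tau>" if "\<tau> \<in> \<T>" for \<tau>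
      using assms(2) that by (auto simp: conforming_mesh_def)
    have fin\<T>: "finite \<T>" using assms(2) by (simp add: conforming_mesh_def)
    have fin\<H>: "finite ?\<H>"
      using fin\<T> simplices finite_facet_planes by (auto simp: facet_hyperplanes_eq)
    have sub: "\<forall>\<tau>\<in>\<T>. facet_planes \<tau> \<subseteq> ?\<H>"
      by (auto simp: facet_hyperplanes_eq)
    have "\<forall>H\<in>?\<H>. \<exists>a b. a \<noteq> 0 \<and> H = {x. a \<bullet> x = b}"
      unfolding facet_hyperplanes_eq using facet_plane_is_hyperplane[OF simplices] by blast
    then obtain a b where ab: "\<And>H. H \<in> ?\<H> \<Longrightarrow> a H \<noteq> 0 \<and> H = {x. a H \<bullet> x = b H}"
      by metis
    have "\<forall>\<tau>\<in>\<T>. \<exists>s. \<tau> = {x. \<forall>H\<in>facet_planes \<tau>. if s H then b H < a H \<bullet> x else a H \<bullet> x < b H}"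
    proof
      fix \<tau> assume \<tau>: "\<tau> \<in> \<T>"
      show "\<exists>s. \<tau> = {x. \<forall>H\<in>facet_planes \<tau>. if s H then b H < a H \<bullet> x else a H \<bullet> x < b H}"
        by (rule open_simplex_sides[OF simplices[OF \<tau>] ab[OF subsetD[OF bspec[OF sub \<tau>]]]])
    qed
    from bchoice[OF this] obtain s where s: "\<forall>\<tau>\<in>\<T>.
        \<tau> = {x. \<forall>H\<in>facet_planes \<tau>. if s \<tau> H then b H < a H \<bullet> x else a H \<bullet> x < b H}" ..
    obtain \<tau>0 where \<tau>0: "\<tau>0 \<in> \<T>" using False by blast
    \<comment> \<open>the facets of a single element already provide enough normals\<close>
    have "span (a ` facet_planes \<tau>0) = UNIV"
      using open_simplex_properties(2,3)[OF simplices[OF \<tau>0]] bspec[OF s \<tau>0]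
      by (rule bounded_cell_normals_span)
    then have span: "span (a ` ?\<H>) = UNIV"
      using span_mono[OF image_mono[OF bspec[OF sub \<tau>0], of a]] by auto
    have bdd: "bounded (closure \<Omega>)" using assms(1) by (simp add: open_polyhedral_def bounded_closure)
    obtain L :: "((real ^ 'd) \<times> real) set" where L: "finite L" "card L \<le> M"
      "\<forall>l\<in>L. \<forall>x\<in>closure \<Omega>. 0 < affine_form l x"
      "\<forall>p\<in>polys k. \<exists>q. \<forall>x. p x = (\<Sum>l\<in>L. q l * affine_form l x ^ k)"
      using positive_powers_basis[OF bdd, of k, folded assms(3)] by (elim exE conjE) (rule that)
    have n2: "card L * card \<T> \<le> M * card \<T>" using L(2) by simp
    obtain W1 :: "nat \<Rightarrow> real ^ 'd" and b1 W20 W21 b2 where net: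
      "\<forall>q. \<exists>W3 :: 1 \<Rightarrow> nat \<Rightarrow> real. \<forall>m. \<forall>x\<in>closure \<Omega>.
         network k (2 * card ?\<H>) (M * card \<T>) W1 b1 W20 W21 b2 W3 x $ m =
         (\<Sum>\<tau>\<in>\<T>. \<Sum>l\<in>L. q \<tau> l *
            (if \<forall>H\<in>facet_planes \<tau>. if s \<tau> H then b H < a H \<bullet> x else a H \<bullet> x < b H
             then affine_form l x ^ k else 0))"
      using gated_hidden_layers[where ?'m = 1 and b = b and s = s and F = facet_planes and k = k,
          OF fin\<H> fin\<T> L(1) sub span bdd L(3) n2]
      by (elim exE) (rule that)
    have "\<exists>W3 :: 1 \<Rightarrow> nat \<Rightarrow> real. \<forall>x\<in>closure \<Omega>.
        v x = network k (2 * card ?\<H>) (M * card \<T>) W1 b1 W20 W21 b2 W3 x $ 1" if v: "v \<in> DG0 k \<T>" for v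
    proof -
      have "\<forall>\<tau>\<in>\<T>. \<exists>q. \<forall>x\<in>\<tau>. v x = (\<Sum>l\<in>L. q l * affine_form l x ^ k)"
      proof
        fix \<tau> assume "\<tau> \<in> \<T>"
        then obtain p where p: "p \<in> polys k" "\<forall>x\<in>\<tau>. v x = p x"
          using v by (auto simp: DG0_def)
        from bspec[OF L(4) p(1)] obtain q where "\<forall>x. p x = (\<Sum>l\<in>L. q l * affine_form l x ^ k)" ..
        with p(2) show "\<exists>q. \<forall>x\<in>\<tau>. v x = (\<Sum>l\<in>L. q l * affine_form l x ^ k)"
          by (intro exI[of _ q]) simp
      qed
      from bchoice[OF this] obtain q where
        q: "\<forall>\<tau>\<in>\<T>. \<forall>x\<in>\<tau>. v x = (\<Sum>l\<in>L. q \<tau> l * affine_form l x ^ k)" ..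
      obtain W3 :: "1 \<Rightarrow> nat \<Rightarrow> real" where W3: "\<forall>x\<in>closure \<Omega>.
         network k (2 * card ?\<H>) (M * card \<T>) W1 b1 W20 W21 b2 W3 x $ 1 =
         (\<Sum>\<tau>\<in>\<T>. \<Sum>l\<in>L. q \<tau> l *
            (if \<forall>H\<in>facet_planes \<tau>. if s \<tau> H then b H < a H \<bullet> x else a H \<bullet> x < b H
             then affine_form l x ^ k else 0))"
        using spec[OF net, of q] by blast
      have "v x = network k (2 * card ?\<H>) (M * card \<T>) W1 b1 W20 W21 b2 W3 x $ 1"
        if x: "x \<in> closure \<Omega>" for x
      proof -
        have mem: "(\<forall>H\<in>facet_planes \<tau>. if s \<tau> H then b H < a H \<bullet> x else a H \<bullet> x < b H) \<longleftrightarrow> x \<in> \<tau>"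
          if "\<tau> \<in> \<T>" for \<tau>
          using bspec[OF s that] by blast
        have net_x: "network k (2 * card ?\<H>) (M * card \<T>) W1 b1 W20 W21 b2 W3 x $ 1 =
            (\<Sum>\<tau>\<in>\<T>. if x \<in> \<tau> then \<Sum>l\<in>L. q \<tau> l * affine_form l x ^ k else 0)"
          unfolding W3[rule_format, OF x] by (intro sum.cong refl) (simp add: mem del: if_split)
        consider "x \<in> skeleton \<T>" | \<tau> where "\<tau> \<in> \<T>" "x \<in> \<tau>"
          using mesh_cover[OF assms(2)] x by blast
        then show ?thesis
        proof cases
          case 1
          then have "x \<notin> \<tau>" if "\<tau> \<in> \<T>" for \<tau>
            using mesh_element_disjoint_skeleton[OF assms(2) that] by blast
          then have "network k (2 * card ?\<H>) (M * card \<T>) W1 b1 W20 W21 b2 W3 x $ 1 = 0"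
            unfolding net_x by (simp add: sum.neutral)
          then show ?thesis using v 1 by (simp add: DG0_def)
        next
          case 2
          then have "x \<in> \<tau>' \<longleftrightarrow> \<tau>' = \<tau>" if "\<tau>' \<in> \<T>" for \<tau>'
            using that assms(2) unfolding conforming_mesh_def by (metis disjnt_iff pairwiseD)
          then have "network k (2 * card ?\<H>) (M * card \<T>) W1 b1 W20 W21 b2 W3 x $ 1 =
              (\<Sum>\<tau>'\<in>\<T>. if \<tau>' = \<tau> then \<Sum>l\<in>L. q \<tau>' l * affine_form l x ^ k else 0)"
            unfolding net_x by (intro sum.cong refl if_cong) auto
          also have "\<dots> = v x" using fin\<T> 2 q by (simp add: sum.delta)
          finally show ?thesis by simp
        qed
      qed
      then show ?thesis by blast
    qed
    then show ?thesis by blast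
  qed
  moreover from this have "\<exists>f\<in>(NN k (2 * card ?\<H>) (M * card \<T>) :: (real ^ 'd \<Rightarrow> real ^ 1) set).
      \<forall>x\<in>closure \<Omega>. v x = f x $ 1" if "v \<in> DG0 k \<T>" for v
    using that unfolding NN_def by blast
  ultimately show ?thesis by blast
qed

end
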